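(* Let $T$ be a tree on $n$ vertices. Then the vertex set of $T$ contains a pair of disjoint homometric sets, each of size at least $\sqrt{\frac{n}{2}} - \frac{1}{2}$.
   Context: All graphs are finite and simple. For a graph $G=(V,E)$ and $V'\subseteq V$, the profile of $V'$ is the multiset of the distances $d_G(u,v)$ over all unordered pairs $\{u,v\}$ of distinct vertices of $V'$. Two disjoint subsets $A,B\subseteq V$ are homometric if their profiles are equal (so in particular $|A|=|B|$); the size of a homometric pair is the common size $|A|=|B|$.
   Formalization: The tree is assumed to have n ≥ 2 vertices; for n = 1 the claim fails, since the bound √(1/2) − 1/2 is positive but a one-vertex tree has no two disjoint nonempty vertex sets. *)

theory Defs
  imports Complex_Main "HOL-Library.Multiset"
begin

definition simple_graph :: "'a set \<Rightarrow> ('a \<Rightarrow> 'a \<Rightarrow> bool) \<Rightarrow> bool" where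
  "simple_graph V E \<longleftrightarrow> finite V \<and> (\<forall>u v. E u v \<longrightarrow> u \<in> V \<and> v \<in> V)
     \<and> (\<forall>u v. E u v \<longrightarrow> E v u) \<and> (\<forall>u. \<not> E u u)"

definition is_walk :: "'a set \<Rightarrow> ('a \<Rightarrow> 'a \<Rightarrow> bool) \<Rightarrow> 'a list \<Rightarrow> bool" where
  "is_walk V E xs \<longleftrightarrow> xs \<noteq> [] \<and> set xs \<subseteq> V \<and>
     (\<forall>i. Suc i < length xs \<longrightarrow> E (xs ! i) (xs ! Suc i))"

definition connected_graph :: "'a set \<Rightarrow> ('a \<Rightarrow> 'a \<Rightarrow> bool) \<Rightarrow> bool" where
  "connected_graph V E \<longleftrightarrow> (\<forall>u\<in>V. \<forall>v\<in>V. \<exists>xs. is_walk V E xs \<and> hd xs = u \<and> last xs = v)"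

definition is_cycle :: "'a set \<Rightarrow> ('a \<Rightarrow> 'a \<Rightarrow> bool) \<Rightarrow> 'a list \<Rightarrow> bool" where
  "is_cycle V E xs \<longleftrightarrow> is_walk V E xs \<and> distinct xs \<and> length xs \<ge> 3 \<and> E (last xs) (hd xs)"

definition acyclic_graph :: "'a set \<Rightarrow> ('a \<Rightarrow> 'a \<Rightarrow> bool) \<Rightarrow> bool" where
  "acyclic_graph V E \<longleftrightarrow> (\<nexists>xs. is_cycle V E xs)"

definition is_tree :: "'a set \<Rightarrow> ('a \<Rightarrow> 'a \<Rightarrow> bool) \<Rightarrow> bool" where
  "is_tree V E \<longleftrightarrow> simple_graph V E \<and> V \<noteq> {} \<and> connected_graph V E \<and> acyclic_graph V E"

definition gdist :: "'a set \<Rightarrow> ('a \<Rightarrow> 'a \<Rightarrow> bool) \<Rightarrow> 'a \<Rightarrow> 'a \<Rightarrow> nat" where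
  "gdist V E u v = (LEAST k. \<exists>xs. is_walk V E xs \<and> hd xs = u \<and> last xs = v \<and> length xs = Suc k)"

text \<open>Distance between the two endpoints of a 2-element set (well defined as
  gdist is symmetric for undirected graphs).\<close>
definition pair_dist :: "'a set \<Rightarrow> ('a \<Rightarrow> 'a \<Rightarrow> bool) \<Rightarrow> 'a set \<Rightarrow> nat" where
  "pair_dist V E e = (let u = (SOME u. u \<in> e); v = (SOME v. v \<in> e \<and> v \<noteq> u) in gdist V E u v)"

definition profile :: "'a set \<Rightarrow> ('a \<Rightarrow> 'a \<Rightarrow> bool) \<Rightarrow> 'a set \<Rightarrow> nat multiset" where
  "profile V E A = image_mset (pair_dist V E) (mset_set {e. e \<subseteq> A \<and> card e = 2})"

definition homometric :: "'a set \<Rightarrow> ('a \<Rightarrow> 'a \<Rightarrow> bool) \<Rightarrow> 'a set \<Rightarrow> 'a set \<Rightarrow> bool" where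
  "homometric V E A B \<longleftrightarrow> A \<subseteq> V \<and> B \<subseteq> V \<and> A \<inter> B = {} \<and> card A = card B
     \<and> profile V E A = profile V E B"

end

theory Submission
  imports Defs "HOL-Library.Transitive_Closure_Table"
begin

text \<open>
  Homometric sets are produced by isometries between disjoint vertex sets, represented by the set
  \<open>P\<close> of pairs of corresponding vertices. If the isometry also preserves the distance to a root
  \<open>r\<close>, then isometries inside different branches at \<open>r\<close> can be united. The paths from \<open>r\<close> to the
  deepest vertices of two branches give such an isometry as well, with as many pairs as the
  shorter path has vertices other than \<open>r\<close>.

  A rooted tree of height \<open>e\<close> therefore has a root-preserving \<open>P\<close> with at least
  \<open>(|T| - 1 - e) / 2e\<close> pairs, i.e. \<open>|T| \<le> 1 + e (2 |P| + 1)\<close>. Inductively, let branch \<open>i\<close> have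
  height \<open>e\<^sub>i \<le> e - 1\<close> and \<open>g\<^sub>i\<close> pairs, so that \<open>|T| - 1\<close> is at most the sum of the
  \<open>(e\<^sub>i + 1) + 2 e\<^sub>i g\<^sub>i\<close>. Uniting gives \<open>|P| \<ge> \<Sum> g\<^sub>i\<close>; matching the branches in order of height
  gives \<open>2 |P| + e \<ge> \<Sum> (e\<^sub>i + 1)\<close>. The larger of the two sets works.

  With the root at a center, the tree contains a path on \<open>2e\<close> vertices, whose halves are
  homometric. So for \<open>s\<close> the maximum of \<open>e\<close> and \<open>|P|\<close> there are homometric sets of size \<open>s\<close>, and
  \<open>n \<le> 1 + s (2s + 1) \<le> 2s (s + 1)\<close>.
\<close>

locale tree_graph =
  fixes V :: "'a set" and E :: "'a \<Rightarrow> 'a \<Rightarrow> bool"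
  assumes tree: "is_tree V E"
begin

section \<open>Distances and shortest paths\<close>

abbreviation d :: "'a \<Rightarrow> 'a \<Rightarrow> nat" where "d \<equiv> gdist V E"

lemma finite_V: "finite V" and V_nonempty: "V \<noteq> {}"
  and edge_in_V: "E u v \<Longrightarrow> u \<in> V \<and> v \<in> V"
  and edge_sym: "E u v \<Longrightarrow> E v u"
  and edge_irrefl: "\<not> E u u"
  using tree unfolding is_tree_def simple_graph_def by blast+

text \<open>A walk on \<open>Suc k\<close> vertices has \<open>k\<close> steps. In terms of relation
  powers, walks can be composed and reversed without handling lists. The start must lie in
  \<open>V\<close> because a walk of length 0 consists of a vertex of \<open>V\<close>, whereas
  \<open>E ^^ 0\<close> relates every element to itself.\<close>

lemma walk_iff_relpowp:
  assumes "u \<in> V"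
  shows "(\<exists>xs. is_walk V E xs \<and> hd xs = u \<and> last xs = v \<and> length xs = Suc k) \<longleftrightarrow> (E ^^ k) u v"
proof
  assume "\<exists>xs. is_walk V E xs \<and> hd xs = u \<and> last xs = v \<and> length xs = Suc k"
  then obtain xs where xs: "is_walk V E xs" "hd xs = u" "last xs = v" "length xs = Suc k"
    by blast
  have "xs ! 0 = u" "xs ! k = v"
    using xs by (auto simp: is_walk_def hd_conv_nth last_conv_nth)
  moreover have "\<forall>i<k. E (xs ! i) (xs ! Suc i)"
    using xs by (auto simp: is_walk_def)
  ultimately show "(E ^^ k) u v"
    unfolding relpowp_fun_conv by blast
next
  assume "(E ^^ k) u v"
  then obtain f where f: "f 0 = u" "f k = v" "\<And>i. i < k \<Longrightarrow> E (f i) (f (Suc i))"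
    unfolding relpowp_fun_conv by blast
  let ?xs = "map f [0..<Suc k]"
  have "f i \<in> V" if "i \<le> k" for i
    using that f assms edge_in_V by (cases i) (auto, metis Suc_le_lessD)
  then have "is_walk V E ?xs"
    using f(3) by (auto simp: is_walk_def nth_append simp del: upt_Suc)
  moreover have "hd ?xs = u" "last ?xs = v"
    using f by (auto simp: hd_map simp del: upt_Suc) (simp add: last_map)
  ultimately show "\<exists>xs. is_walk V E xs \<and> hd xs = u \<and> last xs = v \<and> length xs = Suc k"
    by (intro exI[of _ ?xs]) simp
qed

lemma dist_eq_Least: "u \<in> V \<Longrightarrow> d u v = (LEAST k. (E ^^ k) u v)"
  by (simp add: gdist_def walk_iff_relpowp)

lemma relpowp_dist:
  assumes "u \<in> V" "v \<in> V" shows "(E ^^ d u v) u v"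
proof -
  obtain xs where xs: "is_walk V E xs" "hd xs = u" "last xs = v"
    using tree assms unfolding is_tree_def connected_graph_def by blast
  then have "length xs = Suc (length xs - 1)" by (simp add: is_walk_def)
  with xs have "\<exists>k. (E ^^ k) u v" using walk_iff_relpowp[OF assms(1)] by blast
  then show ?thesis by (metis LeastI_ex assms(1) dist_eq_Least)
qed

lemma dist_le: "u \<in> V \<Longrightarrow> (E ^^ k) u v \<Longrightarrow> d u v \<le> k"
  by (simp add: dist_eq_Least Least_le)

lemma dist_self [simp]: "u \<in> V \<Longrightarrow> d u u = 0"
  using dist_le[of u 0 u] by simp

lemma dist_eq_0_iff: "u \<in> V \<Longrightarrow> v \<in> V \<Longrightarrow> d u v = 0 \<longleftrightarrow> u = v"
  using relpowp_dist[of u v] by auto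

lemma dist_edge: "E u v \<Longrightarrow> d u v = 1"
  using dist_le[of u 1 v] edge_in_V[of u v] edge_irrefl[of u] dist_eq_0_iff[of u v]
  by (cases "d u v") auto

lemma relpowp_sym: "(E ^^ k) u v \<Longrightarrow> (E ^^ k) v u"
proof (induction k arbitrary: v)
  case (Suc k)
  then obtain w where "(E ^^ k) u w" "E w v" by auto
  then show ?case using Suc.IH edge_sym by (metis relpowp_Suc_I2)
qed simp

lemma dist_sym: "u \<in> V \<Longrightarrow> v \<in> V \<Longrightarrow> d u v = d v u"
  using dist_le[OF _ relpowp_sym[OF relpowp_dist]] by (simp add: le_antisym)

lemma dist_triangle:
  assumes "u \<in> V" "v \<in> V" "w \<in> V" shows "d u w \<le> d u v + d v w"
  using assms by (intro dist_le relpowp_trans[of _ _ _ v] relpowp_dist)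

text \<open>A segment of a shortest path is again shortest, since a shortcut would shorten the whole
  path. Both orders of the indices are recorded to spare later appeals to symmetry.\<close>

lemma geodesic_exists:
  assumes "u \<in> V" "v \<in> V"
  obtains z where "z 0 = u" "z (d u v) = v" "\<And>i. i \<le> d u v \<Longrightarrow> z i \<in> V"
    "\<And>i j. i \<le> j \<Longrightarrow> j \<le> d u v \<Longrightarrow> d (z i) (z j) = j - i"
    "\<And>i j. i \<le> j \<Longrightarrow> j \<le> d u v \<Longrightarrow> d (z j) (z i) = j - i"
proof -
  let ?k = "d u v"
  obtain z where z: "z 0 = u" "z ?k = v" "\<And>i. i < ?k \<Longrightarrow> E (z i) (z (Suc i))"
    using relpowp_dist[OF assms] unfolding relpowp_fun_conv by blast
  have zV: "z i \<in> V" if "i \<le> ?k" for i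
    using that z assms edge_in_V by (cases i) (auto, metis Suc_le_lessD)
  have le: "d (z i) (z j) \<le> j - i" if "i \<le> j" "j \<le> ?k" for i j
    using that
  proof (induction j rule: dec_induct)
    case base then show ?case using zV by simp
  next
    case (step j)
    have "d (z i) (z (Suc j)) \<le> d (z i) (z j) + d (z j) (z (Suc j))"
      using step by (intro dist_triangle zV) auto
    then show ?case using step dist_edge[OF z(3)[of j]] by simp
  qed
  have eq: "d (z i) (z j) = j - i" if "i \<le> j" "j \<le> ?k" for i j
  proof -
    have "?k \<le> d u (z i) + d (z i) v" "d (z i) v \<le> d (z i) (z j) + d (z j) v"
      using assms zV that by (intro dist_triangle; simp)+
    moreover have "d u (z i) \<le> i" "d (z j) v \<le> ?k - j"
      using le[of 0 i] le[of j ?k] z that by auto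
    ultimately show ?thesis using le[OF that] that by linarith
  qed
  show ?thesis using that[of z] z zV eq dist_sym by (metis le_trans)
qed

section \<open>Bridges and branches\<close>

text \<open>A path from \<open>c\<close> to \<open>r\<close> that avoids the edge between them can
  be made free of repetitions, and the edge then closes it to a cycle.\<close>

lemma bridge:
  assumes "E r c"
  defines "E' \<equiv> \<lambda>u v. E u v \<and> {u, v} \<noteq> {r, c}"
  shows "\<not> E'\<^sup>*\<^sup>* c r"
proof
  assume "E'\<^sup>*\<^sup>* c r"
  then obtain xs where "rtrancl_path E' c xs r"
    by (auto simp: rtranclp_eq_rtrancl_path)
  then obtain ys where ys: "rtrancl_path E' c ys r" "distinct (c # ys)"
    by (rule rtrancl_path_distinct)
  have "c \<noteq> r" using assms edge_irrefl by metis
  then have "ys \<noteq> []" using ys(1) by (auto elim: rtrancl_path.cases)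
  then have last: "last ys = r" using rtrancl_path_last[OF ys(1)] by simp
  have step: "E' ((c # ys) ! i) (ys ! i)" if "i < length ys" for i
    using rtrancl_path_nth[OF ys(1) that] .
  \<comment> \<open>A single step from \<open>c\<close> to \<open>r\<close> would be the removed
    edge itself, so at least three vertices occur.\<close>
  have "length ys \<noteq> 1"
    using step[of 0] last by (cases ys) (auto simp: E'_def)
  then have len: "length (c # ys) \<ge> 3" using \<open>ys \<noteq> []\<close> by (cases ys) (auto simp: Suc_le_eq)
  have "set (c # ys) \<subseteq> V"
  proof -
    have "ys ! i \<in> V" if "i < length ys" for i
      using step[OF that] edge_in_V by (auto simp: E'_def)
    then show ?thesis using edge_in_V[OF assms(1)] by (auto simp: in_set_conv_nth)
  qed
  then have "is_walk V E (c # ys)" using step by (auto simp: is_walk_def E'_def)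
  then have "is_cycle V E (c # ys)"
    using len ys(2) last \<open>ys \<noteq> []\<close> assms(1) by (simp add: is_cycle_def)
  then show False using tree unfolding is_tree_def acyclic_graph_def by blast
qed

text \<open>For an edge from \<open>r\<close> to \<open>c\<close> in a tree this is the component of
  \<open>c\<close> once the edge is removed. Describing it by distances makes the two sides of an
  edge symmetric: \<open>branch c r\<close> is the other component.\<close>

definition branch :: "'a \<Rightarrow> 'a \<Rightarrow> 'a set" where
  "branch r c = {x \<in> V. d r x = d c x + 1}"

lemma branch_subset: "branch r c \<subseteq> V"
  by (auto simp: branch_def)

lemma finite_branch [simp]: "finite (branch r c)"
  using finite_subset[OF branch_subset finite_V] .

lemma branch_dist: "x \<in> branch r c \<Longrightarrow> d r x = d c x + 1"
  by (simp add: branch_def)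

lemma mem_branch: "E r c \<Longrightarrow> c \<in> branch r c"
  using edge_in_V by (auto simp: branch_def dist_edge)

lemma root_notin_branch: "E r c \<Longrightarrow> r \<notin> branch r c"
  using edge_in_V by (auto simp: branch_def)

text \<open>The bridge separates \<open>x\<close> from \<open>y\<close>, so a shortest path between
  them crosses it from \<open>c\<close> to \<open>r\<close>. The parts before and after the crossing
  have at least \<open>d x c\<close> and \<open>d r y\<close> steps.\<close>

lemma dist_across_edge:
  assumes rc: "E r c" and x: "x \<in> branch r c" and y: "y \<in> V" "y \<notin> branch r c"
  shows "d x y = d x c + 1 + d r y"
proof -
  define E' where "E' = (\<lambda>u v. E u v \<and> {u, v} \<noteq> {r, c})"
  have V: "r \<in> V" "c \<in> V" "x \<in> V" using rc x edge_in_V by (auto simp: branch_def)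
  have not_cr: "\<not> E'\<^sup>*\<^sup>* c r" using bridge[OF rc] by (simp add: E'_def)
  have E'_sym: "E'\<^sup>*\<^sup>* u v \<Longrightarrow> E'\<^sup>*\<^sup>* v u" for u v
    by (rule sympD[OF symp_rtranclp]) (auto simp: E'_def symp_def insert_commute edge_sym)
  \<comment> \<open>If \<open>p\<close> is no farther from \<open>w\<close> than \<open>q\<close>
    is, a shortest path from \<open>p\<close> to \<open>w\<close> never meets \<open>q\<close>,
    hence does not use the edge between them.\<close>
  have avoid: "E'\<^sup>*\<^sup>* p w"
    if pw: "p \<in> V" "w \<in> V" and pq: "{p, q} = {r, c}" and le: "d p w \<le> d q w" for p q w
  proof -
    obtain z where z: "z 0 = p" "z (d p w) = w" "\<And>i. i \<le> d p w \<Longrightarrow> z i \<in> V"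
      "\<And>i j. i \<le> j \<Longrightarrow> j \<le> d p w \<Longrightarrow> d (z i) (z j) = j - i"
      using geodesic_exists[OF pw] by metis
    have "p \<noteq> q" using pq rc edge_irrefl by (metis doubleton_eq_iff)
    have z_ne: "z i \<noteq> q" if "i \<le> d p w" for i
    proof
      assume "z i = q"
      then have "d q w = d p w - i" using z(2) z(4)[of i "d p w"] that by simp
      moreover have "i \<noteq> 0" using \<open>z i = q\<close> z(1) \<open>p \<noteq> q\<close> by metis
      ultimately show False using le that by linarith
    qed
    have "E'\<^sup>*\<^sup>* p (z i)" if "i \<le> d p w" for i
      using that
    proof (induction i)
      case (Suc i)
      have "d (z i) (z (Suc i)) = 1" using z(4)[of i "Suc i"] Suc by simp
      then have "E (z i) (z (Suc i))"
        using relpowp_dist[of "z i" "z (Suc i)"] z(3) Suc.prems by (simp add: eq_OO)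
      moreover have "{z i, z (Suc i)} \<noteq> {r, c}"
        using z_ne[of i] z_ne[of "Suc i"] Suc.prems pq by auto
      ultimately show ?case using Suc by (simp add: E'_def rtranclp.rtrancl_into_rtrancl)
    qed (simp add: z)
    then show ?thesis using z(2) by (metis order_refl)
  qed
  have cx: "E'\<^sup>*\<^sup>* c x" using avoid[of c x r] V branch_dist[OF x] by (simp add: insert_commute)
  \<comment> \<open>Since \<open>d r c = 1\<close>, the triangle inequality leaves only
    \<open>d r y = d c y + 1\<close> above \<open>d c y\<close>, and that case is membership in the
    branch.\<close>
  have "d r y \<le> d r c + d c y" using V y by (intro dist_triangle)
  then have "d r y \<le> d c y" using y dist_edge[OF rc] by (simp add: branch_def)
  then have "E'\<^sup>*\<^sup>* r y" using avoid[of r y c] V y by simp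
  then have ncy: "\<not> E'\<^sup>*\<^sup>* c y" using not_cr E'_sym by (meson rtranclp_trans)
  obtain f where f: "f 0 = x" "f (d x y) = y" "\<And>i. i < d x y \<Longrightarrow> E (f i) (f (Suc i))"
    using relpowp_dist[of x y] V y unfolding relpowp_fun_conv by blast
  \<comment> \<open>The path starts in the component of \<open>c\<close> and ends outside it, and
    only the bridge leads out.\<close>
  have "\<exists>i<d x y. E'\<^sup>*\<^sup>* c (f i) \<and> \<not> E'\<^sup>*\<^sup>* c (f (Suc i))"
  proof (rule ccontr)
    assume *: "\<not> ?thesis"
    have "E'\<^sup>*\<^sup>* c (f i)" if "i \<le> d x y" for i
      using that * cx f(1) by (induction i) auto
    then show False using ncy f(2) by (metis order_refl)
  qed
  then obtain i where i: "i < d x y" "E'\<^sup>*\<^sup>* c (f i)" "\<not> E'\<^sup>*\<^sup>* c (f (Suc i))" by blast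
  then have "\<not> E' (f i) (f (Suc i))" by (meson rtranclp.rtrancl_into_rtrancl)
  then have "{f i, f (Suc i)} = {r, c}" using f(3)[OF i(1)] by (simp add: E'_def)
  then have fi: "f i = c" "f (Suc i) = r"
    using i(2) not_cr by (auto simp: doubleton_eq_iff)
  have "(E ^^ i) x c" unfolding relpowp_fun_conv
    using f fi i(1) by (intro exI[of _ f]) auto
  then have 1: "d x c \<le> i" using dist_le V by blast
  have "(E ^^ (d x y - Suc i)) r y" unfolding relpowp_fun_conv
    using f fi i(1) by (intro exI[of _ "\<lambda>j. f (Suc i + j)"]) auto
  then have 2: "d r y \<le> d x y - Suc i" using dist_le V by blast
  have "d x y \<le> d x c + d c y" "d c y \<le> d c r + d r y"
    using V y by (intro dist_triangle; simp)+
  moreover have "d c r = 1" using dist_edge edge_sym rc by blast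
  ultimately show ?thesis using 1 2 i(1) by linarith
qed

text \<open>For a common vertex \<open>x\<close>, both \<open>c\<close> and \<open>c'\<close> have
  distance \<open>d r x - 1\<close> from \<open>x\<close>; but a path from \<open>x\<close> to
  \<open>c'\<close> would have to pass through \<open>c\<close> and then \<open>r\<close>, which
  makes \<open>c'\<close> farther than \<open>c\<close>.\<close>

lemma branches_disjoint:
  assumes "E r c" "E r c'" "c \<noteq> c'"
  shows "branch r c \<inter> branch r c' = {}"
proof (rule ccontr)
  assume "\<not> ?thesis"
  then obtain x where x: "x \<in> branch r c" "x \<in> branch r c'" by blast
  have V: "c \<in> V" "c' \<in> V" "x \<in> V" using assms x edge_in_V by (auto simp: branch_def)
  have "c' \<notin> branch r c"
    using assms V by (auto simp: branch_def dist_edge dist_eq_0_iff)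
  then have "d x c' = d x c + 1 + d r c'" using dist_across_edge assms x V by blast
  then show False
    using x V assms(2) dist_sym[of x] by (simp add: branch_def dist_edge)
qed

lemma dist_different_branches:
  assumes "E r c" "E r c'" "c \<noteq> c'" "x \<in> branch r c" "y \<in> branch r c'"
  shows "d x y = d r x + d r y"
proof -
  have "y \<notin> branch r c" "y \<in> V" "x \<in> V" "c \<in> V"
    using branches_disjoint[OF assms(1-3)] assms edge_in_V by (auto simp: branch_def)
  then show ?thesis
    using dist_across_edge[OF assms(1,4), of y] branch_dist[OF assms(4)] dist_sym[of x c] by simp
qed

text \<open>\<open>c\<close> is the first vertex after \<open>r\<close> on a shortest path to
  \<open>x\<close>.\<close>

lemma obtain_branch:
  assumes "r \<in> V" "x \<in> V" "x \<noteq> r"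
  obtains c where "E r c" "x \<in> branch r c"
proof -
  obtain k where k: "d r x = Suc k"
    using assms dist_eq_0_iff by (metis not0_implies_Suc)
  obtain c where c: "E r c" "(E ^^ k) c x"
    using relpowp_dist[OF assms(1,2)] k by (metis relpowp_Suc_E2)
  have "d c x \<le> k" using c dist_le edge_in_V by blast
  moreover have "d r x \<le> d r c + d c x" using assms c edge_in_V by (intro dist_triangle) auto
  ultimately show ?thesis using that c(1) assms k dist_edge[OF c(1)] by (simp add: branch_def)
qed

lemma V_eq_branches: "r \<in> V \<Longrightarrow> V = insert r (\<Union>c\<in>{c. E r c}. branch r c)"
  (is "_ \<Longrightarrow> _ = ?R")
proof
  assume r: "r \<in> V"
  show "?R \<subseteq> V" using r branch_subset by auto
  show "V \<subseteq> ?R"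
  proof
    fix x assume "x \<in> V"
    then show "x \<in> ?R" using obtain_branch[OF r, of x] by blast
  qed
qed

lemma branch_opposite:
  assumes "E r c" shows "branch c r = V - branch r c"
proof -
  have "d c y = d r y + 1" if "y \<in> V" "y \<notin> branch r c" for y
    using dist_across_edge[OF assms mem_branch[OF assms] that] edge_in_V[OF assms] by simp
  then show ?thesis by (auto simp: branch_def)
qed

text \<open>This is the recursion behind the later induction: seen from \<open>c\<close>, the branch
  towards \<open>r\<close> is the complement of \<open>branch r c\<close>, so the remaining branches
  at \<open>c\<close> make up the rest of \<open>branch r c\<close>.\<close>

lemma branch_eq_branches:
  assumes "E r c"
  shows "branch r c = insert c (\<Union>c'\<in>{c'. E c c' \<and> c' \<noteq> r}. branch c c')" (is "_ = ?R")
proof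
  show "branch r c \<subseteq> ?R"
  proof
    fix x assume x: "x \<in> branch r c"
    show "x \<in> ?R"
    proof (cases "x = c")
      case False
      then obtain c' where "E c c'" "x \<in> branch c c'"
        using obtain_branch[of c x] x edge_in_V[OF assms] branch_subset by blast
      moreover have "c' \<noteq> r"
        using \<open>x \<in> branch c c'\<close> x branch_opposite[OF assms] by auto
      ultimately show ?thesis by blast
    qed simp
  qed
  have "branch c c' \<subseteq> branch r c" if "E c c'" "c' \<noteq> r" for c'
    using branches_disjoint[OF that(1) edge_sym[OF assms] that(2)] branch_opposite[OF assms]
      branch_subset by blast
  then show "?R \<subseteq> branch r c" using mem_branch[OF assms] by blast
qed

section \<open>Isometric pairings and their unions\<close>

text \<open>The two pairs range independently over \<open>P\<close>, so \<open>a \<noteq> b'\<close>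
  makes the sets of first and of second components disjoint. Equality of distances, applied at
  distance 0, makes both projections injective, so no separate function is needed.\<close>

definition iso_pairs :: "'a set \<Rightarrow> ('a \<times> 'a) set \<Rightarrow> bool" where
  "iso_pairs S P \<longleftrightarrow> P \<subseteq> S \<times> S \<and>
     (\<forall>(a, b)\<in>P. \<forall>(a', b')\<in>P. d a a' = d b b' \<and> a \<noteq> b')"

definition rooted_pairs :: "'a \<Rightarrow> 'a set \<Rightarrow> ('a \<times> 'a) set \<Rightarrow> bool" where
  "rooted_pairs r S P \<longleftrightarrow> iso_pairs S P \<and> (\<forall>(a, b)\<in>P. d r a = d r b)"

lemma rooted_pairs_empty: "rooted_pairs r S {}"
  by (simp add: rooted_pairs_def iso_pairs_def)

lemma rooted_pairs_mono: "rooted_pairs r S P \<Longrightarrow> S \<subseteq> S' \<Longrightarrow> rooted_pairs r S' P"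
  using Sigma_mono[of S S' "\<lambda>_. S" "\<lambda>_. S'"] subset_trans[of P "S \<times> S" "S' \<times> S'"]
  by (simp add: rooted_pairs_def iso_pairs_def)

lemma rooted_pairs_branch: "rooted_pairs r (branch r c) P"
  if P: "rooted_pairs c (branch r c) P"
proof -
  have "d r a = d r b" if "(a, b) \<in> P" for a b
  proof -
    have "a \<in> branch r c" "b \<in> branch r c" "d c a = d c b"
      using P that by (auto simp: rooted_pairs_def iso_pairs_def)
    then show ?thesis by (simp add: branch_dist)
  qed
  moreover have "iso_pairs (branch r c) P" using P unfolding rooted_pairs_def by (rule conjunct1)
  ultimately show ?thesis unfolding rooted_pairs_def by blast
qed

lemma iso_pairs_finite: "iso_pairs S P \<Longrightarrow> S \<subseteq> V \<Longrightarrow> finite P"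
  unfolding iso_pairs_def using finite_subset[of P "S \<times> S"] finite_subset[OF _ finite_V, of S] by simp

text \<open>A distance between the two parts is the sum of the distances to \<open>r\<close>, and
  both pairings preserve these. Hence mixed distances are preserved too.\<close>

lemma rooted_pairs_Un:
  assumes P: "rooted_pairs r S P" and Q: "rooted_pairs r S' Q"
    and V: "S \<subseteq> V" "S' \<subseteq> V" and disj: "S \<inter> S' = {}"
    and dist: "\<And>x y. x \<in> S \<Longrightarrow> y \<in> S' \<Longrightarrow> d x y = d r x + d r y"
  shows "rooted_pairs r (S \<union> S') (P \<union> Q)" and "card (P \<union> Q) = card P + card Q"
proof -
  have dist': "d y x = d r x + d r y" if "x \<in> S" "y \<in> S'" for x y
    using dist[OF that] that V dist_sym by (metis subsetD)
  have memP: "a \<in> S \<and> b \<in> S \<and> d r a = d r b" if "(a, b) \<in> P" for a b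
    using P that by (auto simp: rooted_pairs_def iso_pairs_def)
  have memQ: "a \<in> S' \<and> b \<in> S' \<and> d r a = d r b" if "(a, b) \<in> Q" for a b
    using Q that by (auto simp: rooted_pairs_def iso_pairs_def)
  have PP: "d a a' = d b b' \<and> a \<noteq> b'" if "(a, b) \<in> P" "(a', b') \<in> P" for a b a' b'
    using P that unfolding rooted_pairs_def iso_pairs_def by blast
  have QQ: "d a a' = d b b' \<and> a \<noteq> b'" if "(a, b) \<in> Q" "(a', b') \<in> Q" for a b a' b'
    using Q that unfolding rooted_pairs_def iso_pairs_def by blast
  have PQ: "d a a' = d b b' \<and> a \<noteq> b'" if "(a, b) \<in> P" "(a', b') \<in> Q" for a b a' b'
    using memP[OF that(1)] memQ[OF that(2)] dist disj by auto
  have QP: "d a a' = d b b' \<and> a \<noteq> b'" if "(a, b) \<in> Q" "(a', b') \<in> P" for a b a' b'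
    using memQ[OF that(1)] memP[OF that(2)] dist' disj by auto
  have "d a a' = d b b' \<and> a \<noteq> b'" if "(a, b) \<in> P \<union> Q" "(a', b') \<in> P \<union> Q" for a b a' b'
    using that PP QQ PQ QP by blast
  moreover have "P \<union> Q \<subseteq> (S \<union> S') \<times> (S \<union> S')" "\<forall>(a, b)\<in>P \<union> Q. d r a = d r b"
    using memP memQ by auto
  ultimately show "rooted_pairs r (S \<union> S') (P \<union> Q)"
    unfolding rooted_pairs_def iso_pairs_def by blast
  have "finite P" "finite Q"
    using P Q V iso_pairs_finite by (auto simp: rooted_pairs_def)
  moreover have "P \<inter> Q = {}" using memP memQ disj by fast
  ultimately show "card (P \<union> Q) = card P + card Q" by (rule card_Un_disjoint)
qed

abbreviation branches :: "'a \<Rightarrow> 'a set \<Rightarrow> 'a set" where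
  "branches r C \<equiv> (\<Union>c\<in>C. branch r c)"

lemma dist_branches:
  assumes "\<And>c. c \<in> C \<union> D \<Longrightarrow> E r c" "C \<inter> D = {}" "x \<in> branches r C" "y \<in> branches r D"
  shows "d x y = d r x + d r y"
proof -
  obtain c c' where "c \<in> C" "x \<in> branch r c" "c' \<in> D" "y \<in> branch r c'" using assms by blast
  moreover have "c \<noteq> c'" using calculation assms(2) by blast
  ultimately show ?thesis using dist_different_branches assms(1) by blast
qed

lemma rooted_pairs_branches_Un:
  assumes "\<And>c. c \<in> C \<union> D \<Longrightarrow> E r c" "C \<inter> D = {}"
    and "rooted_pairs r (branches r C) P" "rooted_pairs r (branches r D) Q"
  shows "rooted_pairs r (branches r (C \<union> D)) (P \<union> Q)" and "card (P \<union> Q) = card P + card Q"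
proof -
  have disj: "branches r C \<inter> branches r D = {}"
  proof -
    have "branch r c \<inter> branch r c' = {}" if "c \<in> C" "c' \<in> D" for c c'
      using branches_disjoint[of r c c'] assms(1)[of c] assms(1)[of c'] assms(2) that by blast
    then show ?thesis by blast
  qed
  have V: "branches r C \<subseteq> V" "branches r D \<subseteq> V" using branch_subset by blast+
  note * = rooted_pairs_Un[OF assms(3,4) V disj dist_branches[OF assms(1,2)]]
  show "rooted_pairs r (branches r (C \<union> D)) (P \<union> Q)" using *(1) by (simp add: UN_Un)
  show "card (P \<union> Q) = card P + card Q" using *(2) .
qed

lemma rooted_pairs_sum:
  assumes "finite C" "\<And>c. c \<in> C \<Longrightarrow> E r c" "\<And>c. c \<in> C \<Longrightarrow> rooted_pairs c (branch r c) (P c)"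
  shows "rooted_pairs r (branches r C) (\<Union>c\<in>C. P c) \<and>
    card (\<Union>c\<in>C. P c) = (\<Sum>c\<in>C. card (P c))"
  using assms
proof (induction C)
  case (insert c C)
  have "rooted_pairs r (branches r {c}) (P c)"
    using rooted_pairs_branch insert.prems(2)[of c] by simp
  moreover have "rooted_pairs r (branches r C) (\<Union>c\<in>C. P c)"
    "card (\<Union>c\<in>C. P c) = (\<Sum>c\<in>C. card (P c))"
    using insert.IH insert.prems by auto
  ultimately show ?case
    using rooted_pairs_branches_Un[of "{c}" C r "P c" "\<Union>c\<in>C. P c"] insert by auto
qed (simp add: rooted_pairs_empty)

section \<open>Heights and matching of branches\<close>

text \<open>Measured from \<open>c\<close>, not from \<open>r\<close>: the path from
  \<open>c\<close> to a deepest vertex has \<open>Suc (height r c)\<close> vertices, and that is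
  also the depth of the branch below \<open>r\<close>.\<close>

definition height :: "'a \<Rightarrow> 'a \<Rightarrow> nat" where
  "height r c = Max (d c ` branch r c)"

lemma dist_le_height: "x \<in> branch r c \<Longrightarrow> d c x \<le> height r c"
  by (simp add: height_def)

lemma obtain_branch_path:
  assumes "E r c"
  obtains z where "\<And>i. i \<le> height r c \<Longrightarrow> z i \<in> branch r c"
    "\<And>i. i \<le> height r c \<Longrightarrow> d r (z i) = Suc i"
    "\<And>i j. i \<le> j \<Longrightarrow> j \<le> height r c \<Longrightarrow> d (z i) (z j) = j - i"
    "\<And>i j. i \<le> j \<Longrightarrow> j \<le> height r c \<Longrightarrow> d (z j) (z i) = j - i"
proof -
  have "height r c \<in> d c ` branch r c"
    unfolding height_def using mem_branch[OF assms] by (intro Max_in) auto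
  then obtain x where x: "x \<in> branch r c" "d c x = height r c" by auto
  have V: "c \<in> V" "x \<in> V" "r \<in> V" using x edge_in_V[OF assms] branch_subset by auto
  obtain z where z: "z 0 = c" "z (height r c) = x" "\<And>i. i \<le> height r c \<Longrightarrow> z i \<in> V"
    "\<And>i j. i \<le> j \<Longrightarrow> j \<le> height r c \<Longrightarrow> d (z i) (z j) = j - i"
    "\<And>i j. i \<le> j \<Longrightarrow> j \<le> height r c \<Longrightarrow> d (z j) (z i) = j - i"
    using geodesic_exists[OF V(1,2)] x(2) by metis
  have in_branch: "z i \<in> branch r c" if "i \<le> height r c" for i
  proof (rule ccontr)
    assume "z i \<notin> branch r c"
    \<comment> \<open>Such a vertex would be farther from \<open>x\<close> than \<open>c\<close> is,
      although it lies on a shortest path from \<open>c\<close> to \<open>x\<close>.\<close>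
    then have "d x (z i) = d x c + 1 + d r (z i)"
      using dist_across_edge[OF assms x(1)] z(3) that by blast
    moreover have "d x (z i) = height r c - i" using z(5)[of i "height r c"] z(2) that by simp
    moreover have "d x c = height r c" using dist_sym V x(2) by simp
    ultimately show False by linarith
  qed
  have "d r (z i) = Suc i" if "i \<le> height r c" for i
    using branch_dist[OF in_branch[OF that]] z(4)[of 0 i] z(1) that by simp
  then show ?thesis using that[of z] in_branch z by blast
qed

text \<open>Vertices of equal depth on the two deepest paths are matched, as far as the shorter path
  reaches; inside each path, distances are differences of indices.\<close>

lemma pair_two_branches:
  assumes "E r c" "E r c'" "c \<noteq> c'" "height r c' \<le> height r c"
  obtains P where "rooted_pairs r (branches r {c, c'}) P" "card P = Suc (height r c')"
proof -
  let ?h = "height r c'"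
  obtain z where z: "\<And>i. i \<le> height r c \<Longrightarrow> z i \<in> branch r c"
    "\<And>i. i \<le> height r c \<Longrightarrow> d r (z i) = Suc i"
    "\<And>i j. i \<le> j \<Longrightarrow> j \<le> height r c \<Longrightarrow> d (z i) (z j) = j - i"
    "\<And>i j. i \<le> j \<Longrightarrow> j \<le> height r c \<Longrightarrow> d (z j) (z i) = j - i"
    using obtain_branch_path[OF assms(1)] by metis
  obtain y where y: "\<And>i. i \<le> ?h \<Longrightarrow> y i \<in> branch r c'"
    "\<And>i. i \<le> ?h \<Longrightarrow> d r (y i) = Suc i"
    "\<And>i j. i \<le> j \<Longrightarrow> j \<le> ?h \<Longrightarrow> d (y i) (y j) = j - i"
    "\<And>i j. i \<le> j \<Longrightarrow> j \<le> ?h \<Longrightarrow> d (y j) (y i) = j - i"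
    using obtain_branch_path[OF assms(2)] by metis
  let ?f = "\<lambda>i. (z i, y i)"
  have "d (z i) (z j) = d (y i) (y j)" if "i \<le> ?h" "j \<le> ?h" for i j
    using that z(3,4) y(3,4) assms(4) by (cases "i \<le> j") auto
  moreover have "z i \<noteq> y j" if "i \<le> ?h" "j \<le> ?h" for i j
    using that z(1)[of i] y(1)[of j] branches_disjoint[OF assms(1-3)] assms(4)
    by (metis disjoint_iff le_trans)
  ultimately have "rooted_pairs r (branches r {c, c'}) (?f ` {..?h})"
    using z(1,2) y(1,2) assms(4) by (auto simp: rooted_pairs_def iso_pairs_def)
  moreover have "inj_on ?f {..?h}"
    using y(2) by (intro inj_onI) (metis Suc_inject atMost_iff prod.inject)
  then have "card (?f ` {..?h}) = Suc ?h" by (simp add: card_image)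
  ultimately show ?thesis using that by blast
qed

text \<open>Match the two highest branches with each other, then the next two, and so on: at most
  the height of the first branch is lost.\<close>

lemma pair_branches:
  assumes "finite C" "\<And>c. c \<in> C \<Longrightarrow> E r c" "\<And>c. c \<in> C \<Longrightarrow> Suc (height r c) \<le> M"
  shows "\<exists>P. rooted_pairs r (branches r C) P \<and> (\<Sum>c\<in>C. Suc (height r c)) \<le> 2 * card P + M"
  using assms
proof (induction "card C" arbitrary: C M rule: less_induct)
  case less
  \<comment> \<open>Negating the heights turns the minimum of \<open>arg_min\<close> into a
    maximum.\<close>
  have max: "\<exists>c\<in>D. \<forall>c'\<in>D. height r c' \<le> height r c" if "D \<noteq> {}" "finite D" for D
    using that arg_min_if_finite(1)[of D "\<lambda>c. - int (height r c)"]
      arg_min_least[of D _ "\<lambda>c. - int (height r c)"]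
    by (metis neg_le_iff_le of_nat_le_iff)
  show ?case
  proof (cases "C = {}")
    case True
    then show ?thesis using rooted_pairs_empty by auto
  next
    case False
    then obtain c where c: "c \<in> C" "\<forall>c'\<in>C. height r c' \<le> height r c"
      using max less.prems(1) by blast
    show ?thesis
    proof (cases "C - {c} = {}")
      case True
      then have "C = {c}" using c by blast
      then show ?thesis using less.prems(3)[of c] rooted_pairs_empty by (intro exI[of _ "{}"]) auto
    next
      case False
      then obtain c' where c': "c' \<in> C - {c}" "\<forall>x\<in>C - {c}. height r x \<le> height r c'"
        using max[of "C - {c}"] less.prems(1) by blast
      let ?D = "C - {c} - {c'}"
      have "card ?D < card C"
        using c c' less.prems(1) by (intro psubset_card_mono) auto
      moreover have "Suc (height r x) \<le> Suc (height r c')" if "x \<in> ?D" for x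
        using c' that by auto
      ultimately obtain Q where Q: "rooted_pairs r (branches r ?D) Q"
        "(\<Sum>c\<in>?D. Suc (height r c)) \<le> 2 * card Q + Suc (height r c')"
        using less.hyps[of ?D "Suc (height r c')"] less.prems by auto
      obtain P where P: "rooted_pairs r (branches r {c, c'}) P" "card P = Suc (height r c')"
        using pair_two_branches[of r c c'] c c' less.prems(2) by auto
      have "{c, c'} \<union> ?D = C" using c c' by auto
      then have "rooted_pairs r (branches r C) (P \<union> Q)" "card (P \<union> Q) = card P + card Q"
        using rooted_pairs_branches_Un[of "{c, c'}" ?D r P Q] P(1) Q(1) less.prems(2) by auto
      moreover have "(\<Sum>c\<in>C. Suc (height r c))
          = Suc (height r c) + (Suc (height r c') + (\<Sum>c\<in>?D. Suc (height r c)))"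
        using c c' less.prems(1) by (simp add: sum.remove)
      \<comment> \<open>The matched pair contributes \<open>2 * Suc (height r c')\<close>: one half
        pays for \<open>c'\<close> itself, the other for the loss in the remaining branches, none of
        which is higher than \<open>c'\<close>. The share of \<open>c\<close> is charged to
        \<open>M\<close>.\<close>
      ultimately show ?thesis
        using P(2) Q(2) less.prems(3)[OF c(1)] by (intro exI[of _ "P \<union> Q"]) simp
    qed
  qed
qed

section \<open>The size bound for rooted trees\<close>

lemma card_branches:
  assumes "finite C" "\<And>c. c \<in> C \<Longrightarrow> E r c"
  shows "card (branches r C) = (\<Sum>c\<in>C. card (branch r c))"
proof (rule card_UN_disjoint)
  show "\<forall>c\<in>C. \<forall>c'\<in>C. c \<noteq> c' \<longrightarrow> branch r c \<inter> branch r c' = {}"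
    using assms(2) branches_disjoint by simp
qed (use assms(1) in auto)

text \<open>The induction step shared by branches and the whole tree. The root is not counted, which
  accounts for the missing \<open>1 +\<close> in the conclusion.\<close>

lemma rooted_pairs_step:
  assumes C: "finite C" "\<And>c. c \<in> C \<Longrightarrow> E r c"
    and IH: "\<And>c. c \<in> C \<Longrightarrow> \<exists>P. rooted_pairs c (branch r c) P \<and>
      card (branch r c) \<le> 1 + height r c * (2 * card P + 1)"
    and e: "\<And>c. c \<in> C \<Longrightarrow> Suc (height r c) \<le> e"
  shows "\<exists>P. rooted_pairs r (branches r C) P \<and> card (branches r C) \<le> e * (2 * card P + 1)"
proof (cases "C = {}")
  case True
  then show ?thesis using rooted_pairs_empty by auto
next
  case False
  \<comment> \<open>A branch exists, so \<open>e\<close> is positive, and \<open>m\<close>, which is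
    \<open>e - 1\<close>, bounds every height.\<close>
  then obtain m where m: "e = Suc m" using e by (metis Suc_le_D all_not_in_conv)
  obtain P where P: "\<And>c. c \<in> C \<Longrightarrow> rooted_pairs c (branch r c) (P c)"
    "\<And>c. c \<in> C \<Longrightarrow> card (branch r c) \<le> 1 + height r c * (2 * card (P c) + 1)"
    using IH by metis
  let ?U = "\<Union>c\<in>C. P c"
  have U: "rooted_pairs r (branches r C) ?U" "card ?U = (\<Sum>c\<in>C. card (P c))"
    using rooted_pairs_sum[of C r P] C P(1) by auto
  obtain Q where Q: "rooted_pairs r (branches r C) Q"
    "(\<Sum>c\<in>C. Suc (height r c)) \<le> 2 * card Q + e"
    using pair_branches[OF C e] by blast
  have "card (branches r C) \<le> (\<Sum>c\<in>C. 1 + height r c * (2 * card (P c) + 1))"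
    using card_branches[OF C] P(2) by (simp add: sum_mono)
  also have "\<dots> = (\<Sum>c\<in>C. Suc (height r c) + 2 * (height r c * card (P c)))"
    by (intro sum.cong) (auto simp: algebra_simps)
  also have "\<dots> \<le> (\<Sum>c\<in>C. Suc (height r c) + 2 * (m * card (P c)))"
    using e m by (intro sum_mono add_mono mult_le_mono) auto
  also have "\<dots> = (\<Sum>c\<in>C. Suc (height r c)) + 2 * (m * card ?U)"
    unfolding U(2) by (simp only: sum.distrib sum_distrib_left)
  also have "\<dots> \<le> 2 * card Q + e + 2 * (m * card ?U)"
    using Q(2) by simp
  finally have bound: "card (branches r C) \<le> 2 * card Q + e + 2 * (m * card ?U)" .
  show ?thesis
  \<comment> \<open>With \<open>g\<close> the larger of the two cardinalities, the bound is at most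
    \<open>2 * g + e + 2 * (e - 1) * g\<close>, which equals \<open>e * (2 * g + 1)\<close>.\<close>
  proof (cases "card Q \<le> card ?U")
    case True
    then have "2 * card Q + e + 2 * (m * card ?U) \<le> e * (2 * card ?U + 1)"
      by (simp add: m algebra_simps)
    then show ?thesis using U(1) bound le_trans by blast
  next
    case False
    then have "m * card ?U \<le> m * card Q" by (intro mult_le_mono) auto
    then have "2 * card Q + e + 2 * (m * card ?U) \<le> e * (2 * card Q + 1)"
      by (simp add: m algebra_simps)
    then show ?thesis using Q(1) bound le_trans by blast
  qed
qed

lemma finite_neighbours: "finite {c. E r c}"
  by (rule finite_subset[OF _ finite_V]) (use edge_in_V in blast)

lemma rooted_pairs_in_branch:
  assumes "E r c"
  shows "\<exists>P. rooted_pairs c (branch r c) P \<and> card (branch r c) \<le> 1 + height r c * (2 * card P + 1)"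
  using assms
proof (induction "card (branch r c)" arbitrary: r c rule: less_induct)
  case less
  let ?C = "{c'. E c c' \<and> c' \<noteq> r}"
  have eq: "branch r c = insert c (branches c ?C)" by (rule branch_eq_branches[OF less.prems])
  have notin: "c \<notin> branches c ?C" using root_notin_branch by auto
  have finC: "finite ?C" using finite_neighbours[of c] by (rule rev_finite_subset) auto
  then have fin: "finite (branches c ?C)" by auto
  have card_eq: "card (branch r c) = Suc (card (branches c ?C))" using eq notin fin by simp
  have "\<exists>P. rooted_pairs c (branches c ?C) P \<and>
    card (branches c ?C) \<le> height r c * (2 * card P + 1)"
  proof (rule rooted_pairs_step)
    show "finite ?C" by (rule finC)
    show "E c c'" if "c' \<in> ?C" for c' using that by simp
    fix c' assume c': "c' \<in> ?C"
    have "branch c c' \<subseteq> branches c ?C" using c' by blast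
    then have "card (branch c c') \<le> card (branches c ?C)" using fin by (rule card_mono[rotated])
    then show "\<exists>P. rooted_pairs c' (branch c c') P \<and>
        card (branch c c') \<le> 1 + height c c' * (2 * card P + 1)"
      using less.hyps[of c c'] c' card_eq by simp
    \<comment> \<open>A deepest vertex of a child branch also lies in \<open>branch r c\<close> and
      is one step farther from \<open>c\<close> than from \<open>c'\<close>.\<close>
    have "height c c' \<in> d c' ` branch c c'"
      unfolding height_def using mem_branch c' by (intro Max_in) auto
    then obtain x where x: "x \<in> branch c c'" "d c' x = height c c'" by auto
    then have "x \<in> branch r c" using eq c' by blast
    then show "Suc (height c c') \<le> height r c"
      using dist_le_height[of x r c] branch_dist[OF x(1)] x(2) by simp
  qed
  then obtain P where P: "rooted_pairs c (branches c ?C) P"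
    "card (branches c ?C) \<le> height r c * (2 * card P + 1)" by blast
  have "rooted_pairs c (branch r c) P" using rooted_pairs_mono[OF P(1)] eq by blast
  then show ?case using P(2) card_eq by auto
qed

lemma rooted_pairs_in_V:
  assumes "r \<in> V" "\<And>x. x \<in> V \<Longrightarrow> d r x \<le> e"
  obtains P where "rooted_pairs r V P" "card V \<le> 1 + e * (2 * card P + 1)"
proof -
  let ?C = "{c. E r c}"
  have eq: "V = insert r (branches r ?C)" using V_eq_branches[OF assms(1)] by simp
  have "\<exists>P. rooted_pairs r (branches r ?C) P \<and> card (branches r ?C) \<le> e * (2 * card P + 1)"
  proof (rule rooted_pairs_step)
    show "finite ?C" by (rule finite_neighbours)
    show "E r c" if "c \<in> ?C" for c using that by simp
    fix c assume c: "c \<in> ?C"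
    show "\<exists>P. rooted_pairs c (branch r c) P \<and> card (branch r c) \<le> 1 + height r c * (2 * card P + 1)"
      using rooted_pairs_in_branch c by simp
    have "height r c \<in> d c ` branch r c"
      unfolding height_def using mem_branch c by (intro Max_in) auto
    then obtain x where "x \<in> branch r c" "d c x = height r c" by auto
    then show "Suc (height r c) \<le> e"
      using assms(2)[of x] branch_dist[of x r c] branch_subset by auto
  qed
  then obtain P where P: "rooted_pairs r (branches r ?C) P"
    "card (branches r ?C) \<le> e * (2 * card P + 1)" by blast
  have "card V \<le> Suc (card (branches r ?C))"
    using eq by (metis card_insert_if finite_V finite_insert le_refl le_SucI)
  moreover have "rooted_pairs r V P"
    using rooted_pairs_mono[OF P(1)] eq by blast
  ultimately show ?thesis using that P(2) by simp
qed

section \<open>Long paths through a center\<close>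

text \<open>A shortest path has \<open>Suc (d x y)\<close> vertices; the shift by \<open>e\<close>
  carries its first \<open>e\<close> vertices isometrically onto the next \<open>e\<close>.\<close>

lemma iso_pairs_of_geodesic:
  assumes "x \<in> V" "y \<in> V" "2 * e \<le> Suc (d x y)"
  obtains P where "iso_pairs V P" "card P = e"
proof -
  obtain z where z: "\<And>i. i \<le> d x y \<Longrightarrow> z i \<in> V"
    "\<And>i j. i \<le> j \<Longrightarrow> j \<le> d x y \<Longrightarrow> d (z i) (z j) = j - i"
    "\<And>i j. i \<le> j \<Longrightarrow> j \<le> d x y \<Longrightarrow> d (z j) (z i) = j - i"
    using geodesic_exists[OF assms(1,2)] by metis
  have inj: "i = j" if "z i = z j" "i \<le> d x y" "j \<le> d x y" for i j
    using that z by (metis diff_is_0_eq dist_self le_antisym nle_le)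
  let ?f = "\<lambda>i. (z i, z (e + i))"
  have "d (z i) (z j) = d (z (e + i)) (z (e + j))" if "i < e" "j < e" for i j
    using that z(2,3) assms(3) by (cases "i \<le> j") auto
  moreover have "z i \<noteq> z (e + j)" if "i < e" "j < e" for i j
    using inj[of i "e + j"] that assms(3) by auto
  ultimately have "iso_pairs V (?f ` {..<e})"
    using z(1) assms(3) by (auto simp: iso_pairs_def)
  moreover have "inj_on ?f {..<e}"
    using inj assms(3) by (intro inj_onI) auto
  then have "card (?f ` {..<e}) = e" by (simp add: card_image)
  ultimately show ?thesis using that by blast
qed

text \<open>A root of minimal eccentricity has two branches whose heights differ by at most one;
  otherwise moving the root into the higher branch would decrease the eccentricity.\<close>

lemma obtain_center:
  assumes "card V \<ge> 2"
  obtains r e x y where "r \<in> V" "\<And>x. x \<in> V \<Longrightarrow> d r x \<le> e" "e \<ge> 1"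
    "x \<in> V" "y \<in> V" "2 * e \<le> Suc (d x y)"
proof -
  define ecc where "ecc r = Max (d r ` V)" for r
  have ecc_ge: "d r x \<le> ecc r" if "x \<in> V" for r x
    using that finite_V by (simp add: ecc_def)
  have ecc_att: "\<exists>x\<in>V. d r x = ecc r" for r
  proof -
    have "ecc r \<in> d r ` V" unfolding ecc_def using finite_V V_nonempty by (intro Max_in) auto
    then show ?thesis by auto
  qed
  obtain r where r: "r \<in> V" "\<And>c. c \<in> V \<Longrightarrow> ecc r \<le> ecc c"
    using finite_V V_nonempty arg_min_if_finite(1) arg_min_least by metis
  obtain w where "w \<in> V" "w \<noteq> r"
    using assms by (metis card_le_Suc0_iff_eq finite_V not_less_eq_eq numeral_2_eq_2)
  then have pos: "ecc r \<ge> 1"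
    using ecc_ge[of w r] dist_eq_0_iff[of r w] r(1) by (cases "ecc r") auto
  obtain x where x: "x \<in> V" "d r x = ecc r" using ecc_att by blast
  then have "x \<noteq> r" using pos r(1) by auto
  then obtain c where c: "E r c" "x \<in> branch r c" using obtain_branch r(1) x(1) by blast
  have cV: "c \<in> V" using c edge_in_V by blast
  obtain y where y: "y \<in> V" "d c y = ecc c" using ecc_att by blast
  \<comment> \<open>Minimality forces a vertex \<open>y\<close> at distance at least
    \<open>ecc r\<close> from \<open>c\<close>. Inside the branch of \<open>c\<close> it would be
    still farther from \<open>r\<close>, which is impossible.\<close>
  have "ecc r \<le> d c y" using y r(2)[OF cV] by simp
  moreover have "d r y \<le> ecc r" using ecc_ge y by blast
  ultimately have "y \<notin> branch r c" using branch_dist[of y r c] by linarith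
  then have 1: "d x y = d x c + 1 + d r y" using dist_across_edge c y by blast
  have 2: "d c y \<le> d c r + d r y" using cV r(1) y(1) by (rule dist_triangle)
  have 3: "d c r = 1" using dist_edge edge_sym c(1) by blast
  have 4: "d x c + 1 = ecc r" using branch_dist[OF c(2)] x dist_sym cV by simp
  \<comment> \<open>Here \<open>d x y = ecc r + d r y\<close>, and \<open>d r y\<close> is at least
    \<open>ecc r - 1\<close>.\<close>
  have "2 * ecc r \<le> Suc (d x y)"
    using 1 2 3 4 \<open>ecc r \<le> d c y\<close> by linarith
  then show ?thesis using that[of r "ecc r" x y] r(1) ecc_ge pos x(1) y(1) by blast
qed

section \<open>From isometric pairings to equal profiles\<close>

lemma pair_dist_pair:
  assumes "u \<in> V" "v \<in> V" "u \<noteq> v"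
  shows "pair_dist V E {u, v} = d u v"
proof -
  define a where "a = (SOME a. a \<in> {u, v})"
  define b where "b = (SOME b. b \<in> {u, v} \<and> b \<noteq> a)"
  have a: "a \<in> {u, v}" unfolding a_def by (rule someI[of _ u]) simp
  have "\<exists>b. b \<in> {u, v} \<and> b \<noteq> a" using assms(3) by auto
  then have "b \<in> {u, v} \<and> b \<noteq> a" unfolding b_def by (rule someI_ex)
  then have "d a b = d u v" using a assms dist_sym by auto
  then show ?thesis by (simp add: pair_dist_def Let_def a_def b_def)
qed

text \<open>An injective \<open>f\<close> acts bijectively on the two-element subsets and keeps the
  distance of each, so one profile is a reindexing of the other.\<close>

lemma profile_image:
  assumes "A \<subseteq> V" "f ` A \<subseteq> V" "inj_on f A"
    and iso: "\<And>x y. x \<in> A \<Longrightarrow> y \<in> A \<Longrightarrow> d (f x) (f y) = d x y"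
  shows "profile V E (f ` A) = profile V E A"
proof -
  let ?S = "\<lambda>A. {e. e \<subseteq> A \<and> card e = 2}"
  have card_f: "card (f ` e) = card e" if "e \<subseteq> A" for e
    using card_image inj_on_subset[OF assms(3) that] by blast
  have S: "?S (f ` A) = (`) f ` ?S A"
  proof
    show "?S (f ` A) \<subseteq> (`) f ` ?S A"
    proof
      fix e assume e: "e \<in> ?S (f ` A)"
      then obtain e' where e': "e' \<subseteq> A" "e = f ` e'" by (auto simp: subset_image_iff)
      then have "card e' = 2" using e card_f by auto
      then show "e \<in> (`) f ` ?S A" using e' by blast
    qed
    show "(`) f ` ?S A \<subseteq> ?S (f ` A)"
      using card_f by auto
  qed
  have inj: "inj_on ((`) f) (?S A)"
    using inj_on_image_Pow[OF assms(3)] by (rule inj_on_subset) auto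
  have fin: "finite (?S A)" using finite_subset[OF assms(1) finite_V] by simp
  have "profile V E (f ` A) = image_mset (pair_dist V E) (image_mset ((`) f) (mset_set (?S A)))"
    unfolding profile_def S image_mset_mset_set[OF inj] ..
  also have "\<dots> = image_mset (\<lambda>e. pair_dist V E (f ` e)) (mset_set (?S A))"
    by (simp add: multiset.map_comp comp_def)
  also have "\<dots> = profile V E A"
    unfolding profile_def
  proof (rule image_mset_cong)
    fix e assume "e \<in># mset_set (?S A)"
    then have "e \<subseteq> A" "card e = 2" using fin by auto
    then obtain u v where e: "e = {u, v}" "u \<noteq> v" "u \<in> A" "v \<in> A"
      by (auto simp: card_2_iff)
    then have "f u \<noteq> f v" using assms(3) by (auto dest: inj_onD)
    then show "pair_dist V E (f ` e) = pair_dist V E e"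
      using e assms(1,2) iso pair_dist_pair[of u v] pair_dist_pair[of "f u" "f v"]
      by (simp add: subset_iff)
  qed
  finally show ?thesis .
qed

lemma homometric_of_iso_pairs:
  assumes "iso_pairs V P"
  shows "homometric V E (fst ` P) (snd ` P) \<and> card (fst ` P) = card P"
proof -
  have V: "fst ` P \<subseteq> V" "snd ` P \<subseteq> V" using assms by (auto simp: iso_pairs_def)
  have iso: "d (fst p) (fst q) = d (snd p) (snd q)" "fst p \<noteq> snd q" if "p \<in> P" "q \<in> P" for p q
    using assms that unfolding iso_pairs_def by (metis (mono_tags, lifting) case_prodD prod.collapse)+
  \<comment> \<open>Two vertices coincide exactly when their distance is 0, so an isometry is
    injective in both directions.\<close>
  have eq_iff: "fst p = fst q \<longleftrightarrow> snd p = snd q" if "p \<in> P" "q \<in> P" for p q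
    using iso(1)[OF that] dist_eq_0_iff V that by (metis image_subset_iff)
  have inj_fst: "inj_on fst P" and inj_snd: "inj_on snd P"
    using eq_iff by (auto intro!: inj_onI prod_eqI)
  \<comment> \<open>\<open>f\<close> sends each first component to its partner.\<close>
  define f where "f = snd \<circ> the_inv_into P fst"
  have f: "f (fst p) = snd p" if "p \<in> P" for p
    using that inj_fst by (simp add: f_def the_inv_into_f_f)
  have img: "f ` fst ` P = snd ` P"
    unfolding image_image using f by (intro image_cong) auto
  have "profile V E (f ` fst ` P) = profile V E (fst ` P)"
  proof (rule profile_image)
    show "inj_on f (fst ` P)" using f eq_iff by (auto intro!: inj_onI)
  qed (use V img f iso in auto)
  then have "profile V E (fst ` P) = profile V E (snd ` P)" using img by simp
  moreover have "fst ` P \<inter> snd ` P = {}" using iso(2) by auto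
  ultimately show ?thesis
    using V inj_fst inj_snd by (simp add: homometric_def card_image)
qed

lemma iso_pairs_size_bound:
  assumes "card V \<ge> 2"
  obtains P where "iso_pairs V P" "card V \<le> 2 * card P * (card P + 1)"
proof -
  obtain r e x y where r: "r \<in> V" "\<And>x. x \<in> V \<Longrightarrow> d r x \<le> e" "e \<ge> 1"
    and xy: "x \<in> V" "y \<in> V" "2 * e \<le> Suc (d x y)"
    using obtain_center[OF assms] by metis
  obtain P where P: "rooted_pairs r V P" "card V \<le> 1 + e * (2 * card P + 1)"
    using rooted_pairs_in_V[OF r(1,2)] by metis
  obtain Q where Q: "iso_pairs V Q" "card Q = e"
    using iso_pairs_of_geodesic[OF xy] by metis
  \<comment> \<open>The difference of the two sides is \<open>s - 1\<close>; this is where the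
    positive eccentricity enters.\<close>
  have aux: "1 + s * (2 * s + 1) \<le> 2 * s * (s + 1)" if "s \<ge> 1" for s :: nat
    using that by (simp add: algebra_simps)
  show ?thesis
  proof (cases "card P \<le> e")
    case True
    then have "card V \<le> 1 + e * (2 * e + 1)"
      using P(2) by (meson add_le_mono le_refl le_trans mult_le_mono)
    then show ?thesis using that[of Q] Q aux[OF r(3)] by simp
  next
    case False
    then have "card V \<le> 1 + card P * (2 * card P + 1)"
      using P(2) by (meson add_le_mono le_refl le_trans mult_le_mono nat_le_linear)
    then show ?thesis
      using that[of P] P(1) aux[of "card P"] False r(3) by (simp add: rooted_pairs_def)
  qed
qed

end

theorem theorem1:
  fixes V :: "'a set" and E :: "'a \<Rightarrow> 'a \<Rightarrow> bool" and n :: nat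
  assumes "is_tree V E" and "card V = n" and "n \<ge> 2"
  shows "\<exists>A B. homometric V E A B \<and> real (card A) \<ge> sqrt (real n / 2) - 1 / 2"
proof -
  interpret tree_graph V E by unfold_locales (rule assms(1))
  obtain P where P: "iso_pairs V P" "card V \<le> 2 * card P * (card P + 1)"
    using iso_pairs_size_bound assms by blast
  have "real n \<le> real (2 * card P * (card P + 1))"
    using P(2) assms(2) by (simp only: of_nat_le_iff)
  \<comment> \<open>With \<open>s = card P\<close>, the bound \<open>n / 2 \<le> s * (s + 1)\<close>
    is completed to a square, which adds only \<open>1 / 4\<close>.\<close>
  then have "real n / 2 \<le> (real (card P) + 1 / 2)\<^sup>2"
    by (simp add: power2_eq_square algebra_simps)
  then have "sqrt (real n / 2) \<le> real (card P) + 1 / 2"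
    by (intro real_le_lsqrt) auto
  then show ?thesis using homometric_of_iso_pairs[OF P(1)]
    by (intro exI[of _ "fst ` P"] exI[of _ "snd ` P"]) auto
qed

end
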